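(* Let $K$ be a ring with unit and let $M\subseteq M_n(K)$ be a monoid (under matrix multiplication, containing the identity) consisting of block upper triangular matrices of the form $\begin{pmatrix} A & B\\ 0 & C\end{pmatrix}$ with $A\in M_m(K)$, $C\in M_r(K)$, $B\in M_{m,r}(K)$, $m+r=n$. Let $\varphi\colon M\to M_m(K)\times M_r(K)$ be the projection $\begin{pmatrix} A & B\\ 0 & C\end{pmatrix}\mapsto (A,C)$ to the diagonal blocks, and set $N=\varphi(M)$. Then for all $n_1,n_2\in N$, the monoid $\mathrm{tr}_{\varphi}(n_1,n_2)$ embeds (via an injective monoid homomorphism) in the additive group $M_{m,r}(K)$ of $m\times r$ matrices over $K$.
   Context: For a monoid homomorphism $\varphi\colon M\to N$ and $(n_1,n_2)\in N\times N$, the trace $\mathrm{tr}_{\varphi}(n_1,n_2)$ is the quotient of the submonoid $\{m\in M\mid n_1\varphi(m)=n_1,\ \varphi(m)n_2=n_2\}$ of $M$ by the congruence $\equiv$ defined by $m\equiv m'$ if and only if $m_1mm_2=m_1m'm_2$ for all $m_1\in\varphi^{-1}(n_1)$ and all $m_2\in\varphi^{-1}(n_2)$. Here $N=\varphi(M)$ is a submonoid of the product monoid $M_m(K)\times M_r(K)$. *)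

theory Defs
  imports "HOL-Analysis.Analysis" "HOL-Algebra.Group"
begin

text \<open>Generic trace of a monoid homomorphism phi : M -> N at (n1,n2).
  M is given by its carrier, multiplication and unit; N by its multiplication.\<close>

definition tr_sub ::
  "'a set \<Rightarrow> ('a \<Rightarrow> 'b) \<Rightarrow> ('b \<Rightarrow> 'b \<Rightarrow> 'b) \<Rightarrow> 'b \<Rightarrow> 'b \<Rightarrow> 'a set" where
  "tr_sub M phi nmul n1 n2 = {x \<in> M. nmul n1 (phi x) = n1 \<and> nmul (phi x) n2 = n2}"

definition tr_cong ::
  "'a set \<Rightarrow> ('a \<Rightarrow> 'a \<Rightarrow> 'a) \<Rightarrow> ('a \<Rightarrow> 'b) \<Rightarrow> ('b \<Rightarrow> 'b \<Rightarrow> 'b) \<Rightarrow> 'b \<Rightarrow> 'b \<Rightarrow> ('a \<times> 'a) set" where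
  "tr_cong M mul phi nmul n1 n2 =
     {(x, y). x \<in> tr_sub M phi nmul n1 n2 \<and> y \<in> tr_sub M phi nmul n1 n2 \<and>
        (\<forall>m1 \<in> M. \<forall>m2 \<in> M. phi m1 = n1 \<longrightarrow> phi m2 = n2 \<longrightarrow>
           mul (mul m1 x) m2 = mul (mul m1 y) m2)}"

text \<open>The quotient monoid tr_phi(n1,n2): elements are congruence classes.\<close>
definition trace_monoid ::
  "'a set \<Rightarrow> ('a \<Rightarrow> 'a \<Rightarrow> 'a) \<Rightarrow> 'a \<Rightarrow> ('a \<Rightarrow> 'b) \<Rightarrow> ('b \<Rightarrow> 'b \<Rightarrow> 'b) \<Rightarrow> 'b \<Rightarrow> 'b \<Rightarrow> 'a set monoid" where
  "trace_monoid M mul e phi nmul n1 n2 =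
     \<lparr> carrier = tr_sub M phi nmul n1 n2 // tr_cong M mul phi nmul n1 n2,
       mult = (\<lambda>X Y. \<Union>x\<in>X. \<Union>y\<in>Y. tr_cong M mul phi nmul n1 n2 `` {mul x y}),
       one = tr_cong M mul phi nmul n1 n2 `` {e} \<rparr>"

text \<open>Projection of an (m+r)x(m+r) matrix onto its two diagonal blocks.\<close>
definition diag_blocks ::
  "'k ^ ('m::finite + 'r::finite) ^ ('m + 'r) \<Rightarrow> ('k ^ 'm ^ 'm) \<times> ('k ^ 'r ^ 'r)" where
  "diag_blocks X = ((\<chi> i j. X $ Inl i $ Inl j), (\<chi> i j. X $ Inr i $ Inr j))"

text \<open>Componentwise multiplication in M_m(K) x M_r(K).\<close>
definition pair_mult ::
  "('k::semiring_1 ^ 'm::finite ^ 'm) \<times> ('k ^ 'r::finite ^ 'r) \<Rightarrow> ('k ^ 'm ^ 'm) \<times> ('k ^ 'r ^ 'r)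
     \<Rightarrow> ('k ^ 'm ^ 'm) \<times> ('k ^ 'r ^ 'r)" where
  "pair_mult p q = (fst p ** fst q, snd p ** snd q)"

text \<open>The additive group of m x r matrices, as an Algebra monoid.\<close>
definition add_matrix_monoid :: "('k::ab_group_add ^ 'r::finite ^ 'm::finite) monoid" where
  "add_matrix_monoid = \<lparr> carrier = UNIV, mult = (+), one = 0 \<rparr>"

end

theory Submission
  imports Defs
begin

text \<open>Write the elements of \<open>M\<close> as \<open>[[A, B], [0, C]]\<close> and let \<open>n1 = (A1, C1)\<close>,
  \<open>n2 = (A2, C2)\<close>. If \<open>m1\<close>, \<open>m2\<close> are any representatives of \<open>n1\<close>, \<open>n2\<close> and \<open>x\<close> lies in the
  stabilising submonoid (so \<open>A1 A = A1\<close> and \<open>C C2 = C2\<close>), then \<open>m1 x m2\<close> has the diagonal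
  blocks of \<open>m1 m2\<close> and the upper right block of \<open>m1 m2\<close> plus \<open>A1 B C2\<close>. Hence \<open>x \<equiv> y\<close> iff
  \<open>A1 B C2\<close> agrees for \<open>x\<close> and \<open>y\<close>. The map \<open>x \<mapsto> A1 B C2\<close> is additive on the submonoid,
  because in \<open>A1 (A B' + B C') C2\<close> the diagonal blocks \<open>A\<close> and \<open>C'\<close> are absorbed by \<open>A1\<close>
  and \<open>C2\<close>; so it induces an injective homomorphism of the trace into the \<open>m \<times> r\<close> matrices.\<close>

lemma kernel_class_image:
  assumes "R = {(x, y). x \<in> S \<and> y \<in> S \<and> f x = f y}" and "x \<in> S"
  shows "f ` (R `` {x}) = {f x}"
  using assms by auto

lemma kernel_quotient_embedding:
  fixes G :: "('b, 'c) monoid_scheme"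
  assumes R: "R = {(x, y). x \<in> S \<and> y \<in> S \<and> f x = f y}"
    and mult_closed: "\<And>x y. x \<in> S \<Longrightarrow> y \<in> S \<Longrightarrow> mul x y \<in> S"
    and f_mult: "\<And>x y. x \<in> S \<Longrightarrow> y \<in> S \<Longrightarrow> f (mul x y) = f x \<otimes>\<^bsub>G\<^esub> f y"
    and f_carrier: "f ` S \<subseteq> carrier G"
  shows "(\<lambda>X. the_elem (f ` X))
           \<in> hom \<lparr>carrier = S // R, mult = \<lambda>X Y. \<Union>x\<in>X. \<Union>y\<in>Y. R `` {mul x y}, one = R `` {e}\<rparr> G"
    and "inj_on (\<lambda>X. the_elem (f ` X)) (S // R)"
proof -
  have class_value: "the_elem (f ` (R `` {x})) = f x" if "x \<in> S" for x
    using kernel_class_image[OF R that] by simp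
  show "(\<lambda>X. the_elem (f ` X))
          \<in> hom \<lparr>carrier = S // R, mult = \<lambda>X Y. \<Union>x\<in>X. \<Union>y\<in>Y. R `` {mul x y}, one = R `` {e}\<rparr> G"
  proof (rule homI; simp)
    fix X assume "X \<in> S // R"
    then show "the_elem (f ` X) \<in> carrier G"
      using class_value f_carrier by (auto elim!: quotientE)
  next
    fix X Y assume "X \<in> S // R" "Y \<in> S // R"
    then obtain x y where x: "x \<in> S" "X = R `` {x}" and y: "y \<in> S" "Y = R `` {y}"
      by (auto elim!: quotientE)
    have "f ` (\<Union>x'\<in>X. \<Union>y'\<in>Y. R `` {mul x' y'}) = {f x \<otimes>\<^bsub>G\<^esub> f y}"
    proof (intro equalityI subsetI)
      fix z assume "z \<in> f ` (\<Union>x'\<in>X. \<Union>y'\<in>Y. R `` {mul x' y'})"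
      then show "z \<in> {f x \<otimes>\<^bsub>G\<^esub> f y}"
        using x y by (auto simp: R f_mult)
    next
      have "mul x y \<in> (\<Union>x'\<in>X. \<Union>y'\<in>Y. R `` {mul x' y'})"
        using x y mult_closed by (auto simp: R)
      then show "z \<in> f ` (\<Union>x'\<in>X. \<Union>y'\<in>Y. R `` {mul x' y'})"
        if "z \<in> {f x \<otimes>\<^bsub>G\<^esub> f y}" for z
        using that x y f_mult by force
    qed
    then show "the_elem (f ` (\<Union>x'\<in>X. \<Union>y'\<in>Y. R `` {mul x' y'}))
                 = the_elem (f ` X) \<otimes>\<^bsub>G\<^esub> the_elem (f ` Y)"
      using x y class_value by simp
  qed
  show "inj_on (\<lambda>X. the_elem (f ` X)) (S // R)"
  proof (rule inj_onI)
    fix X Y assume "X \<in> S // R" "Y \<in> S // R" and "the_elem (f ` X) = the_elem (f ` Y)"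
    then show "X = Y"
      using class_value by (auto elim!: quotientE simp: R)
  qed
qed

lemma sum_UNIV_Plus:
  "(\<Sum>k\<in>(UNIV :: ('m::finite + 'r::finite) set). g k) = (\<Sum>k\<in>UNIV. g (Inl k)) + (\<Sum>k\<in>UNIV. g (Inr k))"
  using sum.Plus[of "UNIV :: 'm set" "UNIV :: 'r set" g] by (simp add: comp_def)

lemma matrix_add_rdistrib: "(B + C) ** A = B ** A + C ** (A :: 'a::semiring_1 ^ 'n ^ 'p)"
  by (vector matrix_matrix_mult_def sum.distrib[symmetric] field_simps)

definition ul_block :: "'k ^ ('m::finite + 'r::finite) ^ ('m + 'r) \<Rightarrow> 'k ^ 'm ^ 'm" where
  "ul_block X = (\<chi> i j. X $ Inl i $ Inl j)"

definition ur_block :: "'k ^ ('m::finite + 'r::finite) ^ ('m + 'r) \<Rightarrow> 'k ^ 'r ^ 'm" where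
  "ur_block X = (\<chi> i j. X $ Inl i $ Inr j)"

definition lr_block :: "'k ^ ('m::finite + 'r::finite) ^ ('m + 'r) \<Rightarrow> 'k ^ 'r ^ 'r" where
  "lr_block X = (\<chi> i j. X $ Inr i $ Inr j)"

definition block_upper :: "'k::zero ^ ('m::finite + 'r::finite) ^ ('m + 'r) \<Rightarrow> bool" where
  "block_upper X \<longleftrightarrow> (\<forall>i j. X $ Inr i $ Inl j = 0)"

lemma diag_blocks_eq: "diag_blocks X = (ul_block X, lr_block X)"
  by (simp add: diag_blocks_def ul_block_def lr_block_def)

context
  fixes X Y :: "'k::semiring_1 ^ ('m::finite + 'r::finite) ^ ('m + 'r)"
begin

lemma ul_block_mult: "block_upper Y \<Longrightarrow> ul_block (X ** Y) = ul_block X ** ul_block Y"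
  by (simp add: block_upper_def ul_block_def matrix_matrix_mult_def vec_eq_iff sum_UNIV_Plus)

lemma lr_block_mult: "block_upper X \<Longrightarrow> lr_block (X ** Y) = lr_block X ** lr_block Y"
  by (simp add: block_upper_def lr_block_def matrix_matrix_mult_def vec_eq_iff sum_UNIV_Plus)

lemma ur_block_mult: "ur_block (X ** Y) = ul_block X ** ur_block Y + ur_block X ** lr_block Y"
  by (simp add: ul_block_def ur_block_def lr_block_def matrix_matrix_mult_def vec_eq_iff
      sum_UNIV_Plus)

lemma block_upper_eqI:
  assumes "block_upper X" "block_upper Y"
    and "ul_block X = ul_block Y" "ur_block X = ur_block Y" "lr_block X = lr_block Y"
  shows "X = Y"
proof -
  have "X $ i $ j = Y $ i $ j" for i j
    using assms unfolding block_upper_def ul_block_def ur_block_def lr_block_def vec_eq_iff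
    by (cases i; cases j) simp_all
  then show ?thesis by (simp add: vec_eq_iff)
qed

end

lemma blocks_mat_1:
  "ul_block (mat 1 :: 'k::semiring_1 ^ ('m::finite + 'r::finite) ^ ('m + 'r)) = mat 1"
  "ur_block (mat 1 :: 'k::semiring_1 ^ ('m::finite + 'r::finite) ^ ('m + 'r)) = 0"
  "lr_block (mat 1 :: 'k::semiring_1 ^ ('m::finite + 'r::finite) ^ ('m + 'r)) = mat 1"
  by (simp_all add: ul_block_def ur_block_def lr_block_def mat_def vec_eq_iff)

lemma tr_sub_diag_blocks_iff:
  "x \<in> tr_sub M diag_blocks pair_mult n1 n2 \<longleftrightarrow>
     x \<in> M \<and> fst n1 ** ul_block x = fst n1 \<and> snd n1 ** lr_block x = snd n1
       \<and> ul_block x ** fst n2 = fst n2 \<and> lr_block x ** snd n2 = snd n2"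
  by (cases n1; cases n2) (auto simp: tr_sub_def pair_mult_def diag_blocks_eq)

definition sandwich_corner ::
  "('k::semiring_1 ^ 'm ^ 'm) \<times> ('k ^ 'r ^ 'r) \<Rightarrow> ('k ^ 'm ^ 'm) \<times> ('k ^ 'r ^ 'r)
     \<Rightarrow> 'k ^ ('m::finite + 'r::finite) ^ ('m + 'r) \<Rightarrow> 'k ^ 'r ^ 'm" where
  "sandwich_corner n1 n2 x = fst n1 ** ur_block x ** snd n2"

locale block_triangular_monoid =
  fixes M :: "('k::ring_1 ^ ('m::finite + 'r::finite) ^ ('m + 'r)) set"
  assumes mat_1_in: "mat 1 \<in> M"
    and mult_closed: "X \<in> M \<Longrightarrow> Y \<in> M \<Longrightarrow> X ** Y \<in> M"
    and block_upper: "X \<in> M \<Longrightarrow> block_upper X"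
begin

abbreviation stab ::
  "('k ^ 'm ^ 'm) \<times> ('k ^ 'r ^ 'r) \<Rightarrow> ('k ^ 'm ^ 'm) \<times> ('k ^ 'r ^ 'r)
     \<Rightarrow> ('k ^ ('m + 'r) ^ ('m + 'r)) set" where
  "stab n1 n2 \<equiv> tr_sub M diag_blocks pair_mult n1 n2"

lemma mat_1_in_stab: "mat 1 \<in> stab n1 n2"
  by (simp add: tr_sub_diag_blocks_iff mat_1_in blocks_mat_1)

lemma stab_mult_closed:
  assumes "x \<in> stab n1 n2" "y \<in> stab n1 n2"
  shows "x ** y \<in> stab n1 n2"
proof -
  have "x \<in> M" "y \<in> M" using assms by (auto simp: tr_sub_diag_blocks_iff)
  then have "ul_block (x ** y) = ul_block x ** ul_block y"
    and "lr_block (x ** y) = lr_block x ** lr_block y"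
    by (simp_all add: ul_block_mult lr_block_mult block_upper)
  with assms \<open>x \<in> M\<close> \<open>y \<in> M\<close> show ?thesis
    by (simp add: tr_sub_diag_blocks_iff mult_closed flip: matrix_mul_assoc)
      (simp add: matrix_mul_assoc)
qed

lemma sandwich_corner_mult:
  assumes x: "x \<in> stab n1 n2" and y: "y \<in> stab n1 n2"
  shows "sandwich_corner n1 n2 (x ** y) = sandwich_corner n1 n2 x + sandwich_corner n1 n2 y"
proof -
  have "sandwich_corner n1 n2 (x ** y)
      = (fst n1 ** ul_block x) ** ur_block y ** snd n2
        + fst n1 ** ur_block x ** (lr_block y ** snd n2)"
    by (simp add: sandwich_corner_def ur_block_mult matrix_add_ldistrib matrix_add_rdistrib
        matrix_mul_assoc)
  also have "\<dots> = sandwich_corner n1 n2 y + sandwich_corner n1 n2 x"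
    using x y by (simp add: tr_sub_diag_blocks_iff sandwich_corner_def)
  finally show ?thesis by (simp add: add.commute)
qed

lemma sandwich_blocks:
  assumes x: "x \<in> stab n1 n2"
    and m1: "m1 \<in> M" "diag_blocks m1 = n1" and m2: "m2 \<in> M" "diag_blocks m2 = n2"
  shows "ul_block (m1 ** x ** m2) = ul_block (m1 ** m2)"
    and "lr_block (m1 ** x ** m2) = lr_block (m1 ** m2)"
    and "ur_block (m1 ** x ** m2) = ur_block (m1 ** m2) + sandwich_corner n1 n2 x"
proof -
  have "x \<in> M" and ul1: "ul_block m1 = fst n1" and lr2: "lr_block m2 = snd n2"
    using x m1 m2 by (auto simp: tr_sub_diag_blocks_iff diag_blocks_eq)
  have stable: "ul_block m1 ** ul_block x = ul_block m1" "lr_block x ** lr_block m2 = lr_block m2"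
    using x ul1 lr2 by (simp_all add: tr_sub_diag_blocks_iff)
  have upper: "block_upper m1" "block_upper x" "block_upper m2" "block_upper (m1 ** x)"
    using \<open>x \<in> M\<close> m1 m2 by (simp_all add: block_upper mult_closed)
  show "ul_block (m1 ** x ** m2) = ul_block (m1 ** m2)"
    using upper stable by (simp add: ul_block_mult)
  show "lr_block (m1 ** x ** m2) = lr_block (m1 ** m2)"
    using upper stable by (simp add: lr_block_mult flip: matrix_mul_assoc)
  have "ur_block (m1 ** x ** m2)
      = (ul_block m1 ** ul_block x) ** ur_block m2
        + ul_block m1 ** ur_block x ** lr_block m2 + ur_block m1 ** (lr_block x ** lr_block m2)"
    using upper by (simp add: ur_block_mult ul_block_mult matrix_add_rdistrib matrix_mul_assoc
        add.assoc)
  also have "\<dots> = ur_block (m1 ** m2) + sandwich_corner n1 n2 x"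
    using stable ul1 lr2 by (simp add: ur_block_mult sandwich_corner_def ac_simps)
  finally show "ur_block (m1 ** x ** m2) = ur_block (m1 ** m2) + sandwich_corner n1 n2 x" .
qed

lemma sandwich_eq_iff:
  assumes x: "x \<in> stab n1 n2" and y: "y \<in> stab n1 n2"
    and m1: "m1 \<in> M" "diag_blocks m1 = n1" and m2: "m2 \<in> M" "diag_blocks m2 = n2"
  shows "m1 ** x ** m2 = m1 ** y ** m2 \<longleftrightarrow> sandwich_corner n1 n2 x = sandwich_corner n1 n2 y"
proof
  assume "m1 ** x ** m2 = m1 ** y ** m2"
  then show "sandwich_corner n1 n2 x = sandwich_corner n1 n2 y"
    using sandwich_blocks(3)[OF x m1 m2] sandwich_blocks(3)[OF y m1 m2] by simp
next
  have "x \<in> M" "y \<in> M" using x y by (auto simp: tr_sub_diag_blocks_iff)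
  then have "block_upper (m1 ** x ** m2)" "block_upper (m1 ** y ** m2)"
    using m1 m2 by (simp_all add: block_upper mult_closed)
  moreover assume "sandwich_corner n1 n2 x = sandwich_corner n1 n2 y"
  ultimately show "m1 ** x ** m2 = m1 ** y ** m2"
    using sandwich_blocks[OF x m1 m2] sandwich_blocks[OF y m1 m2]
    by (intro block_upper_eqI) simp_all
qed

lemma tr_cong_eq_kernel:
  assumes "n1 \<in> diag_blocks ` M" "n2 \<in> diag_blocks ` M"
  shows "tr_cong M (**) diag_blocks pair_mult n1 n2
           = {(x, y). x \<in> stab n1 n2 \<and> y \<in> stab n1 n2
                      \<and> sandwich_corner n1 n2 x = sandwich_corner n1 n2 y}"
proof -
  obtain m1 m2 where m1: "m1 \<in> M" "diag_blocks m1 = n1" and m2: "m2 \<in> M" "diag_blocks m2 = n2"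
    using assms by blast
  show ?thesis
    unfolding tr_cong_def using sandwich_eq_iff m1 m2 by blast
qed

end

theorem lemma3p2:
  fixes M :: "('k::ring_1 ^ ('m::finite + 'r::finite) ^ ('m + 'r)) set"
  assumes one_in: "mat 1 \<in> M"
    and mult_closed: "\<And>X Y. X \<in> M \<Longrightarrow> Y \<in> M \<Longrightarrow> X ** Y \<in> M"
    and block_upper: "\<And>X i j. X \<in> M \<Longrightarrow> X $ Inr i $ Inl j = 0"
    and n1: "n1 \<in> diag_blocks ` M"
    and n2: "n2 \<in> diag_blocks ` M"
  shows "\<exists>h. h \<in> hom (trace_monoid M (**) (mat 1) diag_blocks pair_mult n1 n2)
                     (add_matrix_monoid :: ('k ^ 'r ^ 'm) monoid)
            \<and> h (one (trace_monoid M (**) (mat 1) diag_blocks pair_mult n1 n2)) = 0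
            \<and> inj_on h (carrier (trace_monoid M (**) (mat 1) diag_blocks pair_mult n1 n2))"
proof -
  interpret block_triangular_monoid M
    by standard (simp_all add: one_in mult_closed block_upper block_upper_def)
  let ?f = "sandwich_corner n1 n2"
  note kernel = tr_cong_eq_kernel[OF n1 n2]
  have "(\<lambda>X. the_elem (?f ` X))
          \<in> hom (trace_monoid M (**) (mat 1) diag_blocks pair_mult n1 n2) add_matrix_monoid"
    using kernel_quotient_embedding(1)[OF kernel, of "(**)" add_matrix_monoid "mat 1"]
    by (simp add: trace_monoid_def add_matrix_monoid_def stab_mult_closed sandwich_corner_mult)
  moreover have "inj_on (\<lambda>X. the_elem (?f ` X))
          (carrier (trace_monoid M (**) (mat 1) diag_blocks pair_mult n1 n2))"
    using kernel_quotient_embedding(2)[OF kernel, of "(**)" add_matrix_monoid]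
    by (simp add: trace_monoid_def add_matrix_monoid_def stab_mult_closed sandwich_corner_mult)
  moreover have "the_elem (?f ` one (trace_monoid M (**) (mat 1) diag_blocks pair_mult n1 n2)) = 0"
    using kernel_class_image[OF kernel mat_1_in_stab]
    by (simp add: trace_monoid_def sandwich_corner_def blocks_mat_1)
  ultimately show ?thesis by blast
qed

end
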